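(* Let $q\in\mathbb{C}^*$, $n\ge1$, $k\ge1$, and let $V=V_1\oplus V_2$ with $V_1=\mathbb{C}v_0$ and $V_2=\mathbb{C}\text{-span}\{v_1,\dots,v_n\}$. Consider the Sakamoto–Shoji action $\Phi_P:H_k(0,1;q)\to\mathrm{End}(V^{\otimes k})$ (the case $r=2$, $m_1=1$, $m_2=n$, $u_1=0$, $u_2=1$), given by $$\Phi_P(T_i)=\check R_i,\qquad \Phi_P(X_1)=\check R_1^{-1}\cdots\check R_{k-1}^{-1}\check S_{k-1}\cdots\check S_1d_1 .$$ Then $\Phi_P(X_1)=d_1$; that is, $\Phi_P(X_1)(v_0\otimes v_{i_2}\otimes\cdots\otimes v_{i_k})=0$ and, for $\ell>0$, $\Phi_P(X_1)(v_\ell\otimes v_{i_2}\otimes\cdots\otimes v_{i_k})=v_\ell\otimes v_{i_2}\otimes\cdots\otimes v_{i_k}$.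
   Context: $H_k(0,1;q)$ is the $\mathbb{C}$-algebra with generators $X_1,T_1,\dots,T_{k-1}$ and relations $T_iT_j=T_jT_i$ for $|i-j|>1$; $T_iT_{i+1}T_i=T_{i+1}T_iT_{i+1}$; $T_i^2=(q-q^{-1})T_i+1$; $X_1T_j=T_jX_1$ for $2\le j\le k-1$; $X_1T_1X_1T_1=T_1X_1T_1X_1$; $X_1(X_1-1)=0$. That $\Phi_P$ defines an action of this algebra is a cited result of Sakamoto and Shoji. $\check R_{VV}:V\otimes V\to V\otimes V$ is, for $0\le i,j\le n$, $\check R_{VV}(v_i\otimes v_j)=q\,v_j\otimes v_i$ if $i=j$; $=v_j\otimes v_i$ if $i>j$; $=v_j\otimes v_i+(q-q^{-1})v_i\otimes v_j$ if $i<j$. Let $\deg(v_0)=1$ and $\deg(v_i)=2$ for $i\geq 1$. $\check S_{VV}(v_i\otimes v_j)=\check R_{VV}(v_i\otimes v_j)$ if $\deg(v_i)=\deg(v_j)$ and $\check S_{VV}(v_i\otimes v_j)=v_j\otimes v_i$ if $\deg(v_i)\neq\deg(v_j)$. The map $d:V\to V$ is $d(v_0)=0$, $d(v_i)=v_i$ for $i\ge1$. On $V^{\otimes k}$ let $d_i=\mathrm{id}_V^{\otimes(i-1)}\otimes d\otimes\mathrm{id}_V^{\otimes(k-i)}$, $\check R_i=\mathrm{id}_V^{\otimes(i-1)}\otimes\check R_{VV}\otimes\mathrm{id}_V^{\otimes(k-i-1)}$, $\check S_i=\mathrm{id}_V^{\otimes(i-1)}\otimes\check S_{VV}\otimes\mathrm{id}_V^{\otimes(k-i-1)}$.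 *)

theory Defs
  imports Complex_Main "HOL-Library.Poly_Mapping" "HOL-Algebra.Algebra"
begin

text \<open>
  The (not necessarily commutative) complex algebras below are values of the record type
  \<^typ>\<open>(complex, 'a) module\<close>, i.e. rings with a scalar multiplication. The library locale
  \<^locale>\<open>algebra\<close> is not used, since it requires commutativity.
\<close>

definition calg_hom ::
    "(complex, 'a) module \<Rightarrow> (complex, 'b) module \<Rightarrow> ('a \<Rightarrow> 'b) set" where
  "calg_hom A B =
     {\<Phi> \<in> ring_hom A B. \<forall>c. \<forall>x \<in> carrier A. \<Phi> (c \<odot>\<^bsub>A\<^esub> x) = c \<odot>\<^bsub>B\<^esub> \<Phi> x}"

datatype hecke_gen = GenX | GenT nat

datatype word = Word (letters: "hecke_gen list")

instantiation word :: monoid_add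
begin
definition "0 = Word []"
definition "v + w = Word (letters v @ letters w)"
instance by standard (simp_all add: zero_word_def plus_word_def)
end

text \<open>
  With concatenation as addition of words, the convolution product of finitely supported
  functions \<^typ>\<open>word \<Rightarrow>\<^sub>0 complex\<close> is multiplication of noncommutative polynomials.
\<close>

type_synonym ncpoly = "word \<Rightarrow>\<^sub>0 complex"

definition gens :: "nat \<Rightarrow> hecke_gen set" where
  "gens k = insert GenX (GenT ` {1..<k})"

definition const :: "complex \<Rightarrow> ncpoly" where
  "const c = Poly_Mapping.single 0 c"

definition var :: "hecke_gen \<Rightarrow> ncpoly" where
  "var g = Poly_Mapping.single (Word [g]) 1"

abbreviation X\<^sub>1 :: ncpoly where "X\<^sub>1 \<equiv> var GenX"
abbreviation T :: "nat \<Rightarrow> ncpoly" where "T i \<equiv> var (GenT i)"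

definition free_alg :: "nat \<Rightarrow> (complex, ncpoly) module" where
  "free_alg k =
    \<lparr>carrier = {p. \<forall>w \<in> Poly_Mapping.keys p. set (letters w) \<subseteq> gens k},
     monoid.mult = (*), one = 1, ring.zero = 0, add = (+), smult = (\<lambda>c p. const c * p)\<rparr>"

definition hecke_rels :: "nat \<Rightarrow> complex \<Rightarrow> ncpoly set" where
  "hecke_rels k q =
     {T i * T j - T j * T i | i j.
        i \<in> {1..<k} \<and> j \<in> {1..<k} \<and> \<bar>int i - int j\<bar> > 1}
   \<union> {T i * T (i+1) * T i - T (i+1) * T i * T (i+1) | i.
        i \<in> {1..<k} \<and> i + 1 \<in> {1..<k}}
   \<union> {T i * T i - (const (q - inverse q) * T i + 1) | i. i \<in> {1..<k}}
   \<union> {X\<^sub>1 * T j - T j * X\<^sub>1 | j. j \<in> {2..<k}}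
   \<union> (if k \<ge> 2 then {X\<^sub>1 * T 1 * X\<^sub>1 * T 1 - T 1 * X\<^sub>1 * T 1 * X\<^sub>1} else {})
   \<union> {X\<^sub>1 * (X\<^sub>1 - 1)}"

text \<open>
  \<^const>\<open>genideal\<close> and \<^const>\<open>FactRing\<close> are the two-sided ideal generated by a set
  and the ring of its cosets, also over noncommutative rings.
\<close>

definition hecke_ideal :: "nat \<Rightarrow> complex \<Rightarrow> ncpoly set" where
  "hecke_ideal k q = Idl\<^bsub>free_alg k\<^esub> (hecke_rels k q)"

definition hecke_class :: "nat \<Rightarrow> complex \<Rightarrow> ncpoly \<Rightarrow> ncpoly set" where
  "hecke_class k q p = hecke_ideal k q +>\<^bsub>free_alg k\<^esub> p"

definition hecke_alg :: "nat \<Rightarrow> complex \<Rightarrow> (complex, ncpoly set) module" where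
  "hecke_alg k q =
     ring.extend (free_alg k Quot hecke_ideal k q)
       (module.fields
         (\<lambda>c x. hecke_class k q (const c) \<otimes>\<^bsub>free_alg k Quot hecke_ideal k q\<^esub> x))"

text \<open>
  \<open>V\<close> has basis \<open>v\<^sub>0, \<dots>, v\<^sub>n\<close>. A vector of the \<open>m\<close>-th tensor power is given by its
  coordinates: the function sending a list \<open>[a, \<dots>, b]\<close> of \<open>m\<close> indices to the coefficient of
  \<open>v\<^sub>a \<otimes> \<dots> \<otimes> v\<^sub>b\<close>. In particular \<open>tpow n 1\<close> is \<open>V\<close>.
\<close>

type_synonym tensor = "nat list \<Rightarrow> complex"

definition idx :: "nat \<Rightarrow> nat \<Rightarrow> nat list set" where
  "idx n m = {xs. length xs = m \<and> set xs \<subseteq> {0..n}}"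

definition tpow :: "nat \<Rightarrow> nat \<Rightarrow> tensor set" where
  "tpow n m = {u. \<forall>xs. xs \<notin> idx n m \<longrightarrow> u xs = 0}"

definition tzero :: tensor where "tzero = (\<lambda>xs. 0)"
definition tadd :: "tensor \<Rightarrow> tensor \<Rightarrow> tensor" where "tadd u w = (\<lambda>xs. u xs + w xs)"
definition tscale :: "complex \<Rightarrow> tensor \<Rightarrow> tensor" where "tscale c u = (\<lambda>xs. c * u xs)"

text \<open>\<open>bas [a, \<dots>, b]\<close> is the pure tensor \<open>v\<^sub>a \<otimes> \<dots> \<otimes> v\<^sub>b\<close>.\<close>

definition bas :: "nat list \<Rightarrow> tensor" where
  "bas xs = (\<lambda>ys. if ys = xs then 1 else 0)"

text \<open>Product of a tensor of degree \<open>a\<close> with a tensor of arbitrary degree.\<close>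

definition tensor_vec :: "nat \<Rightarrow> tensor \<Rightarrow> tensor \<Rightarrow> tensor" where
  "tensor_vec a u w = (\<lambda>xs. u (take a xs) * w (drop a xs))"

text \<open>Linear endomorphism of \<open>tpow n m\<close> with prescribed values on the basis.\<close>

definition lin_ext :: "nat \<Rightarrow> nat \<Rightarrow> (nat list \<Rightarrow> tensor) \<Rightarrow> tensor \<Rightarrow> tensor" where
  "lin_ext n m f = (\<lambda>u \<in> tpow n m. \<lambda>ys. \<Sum>xs \<in> idx n m. u xs * f xs ys)"

definition tensor_op ::
    "nat \<Rightarrow> nat \<Rightarrow> nat \<Rightarrow> (tensor \<Rightarrow> tensor) \<Rightarrow> (tensor \<Rightarrow> tensor) \<Rightarrow> tensor \<Rightarrow> tensor" where
  "tensor_op n a b A B =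
     lin_ext n (a + b) (\<lambda>xs. tensor_vec a (A (bas (take a xs))) (B (bas (drop a xs))))"

definition id_op :: "nat \<Rightarrow> nat \<Rightarrow> tensor \<Rightarrow> tensor" where
  "id_op n m = (\<lambda>u \<in> tpow n m. u)"

text \<open>
  The algebra of linear endomorphisms. Its elements are extensional functions, so that
  equality in it is equality of maps on \<open>tpow n m\<close>.
\<close>

definition End_alg :: "nat \<Rightarrow> nat \<Rightarrow> (complex, tensor \<Rightarrow> tensor) module" where
  "End_alg n m =
    \<lparr>carrier = {A \<in> tpow n m \<rightarrow>\<^sub>E tpow n m.
        (\<forall>u \<in> tpow n m. \<forall>w \<in> tpow n m. A (tadd u w) = tadd (A u) (A w)) \<and>
        (\<forall>c. \<forall>u \<in> tpow n m. A (tscale c u) = tscale c (A u))},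
     monoid.mult = compose (tpow n m),
     one = id_op n m,
     ring.zero = (\<lambda>u \<in> tpow n m. tzero),
     add = (\<lambda>A B. \<lambda>u \<in> tpow n m. tadd (A u) (B u)),
     smult = (\<lambda>c A. \<lambda>u \<in> tpow n m. tscale c (A u))\<rparr>"

definition vdeg :: "nat \<Rightarrow> nat" where
  "vdeg i = (if i = 0 then 1 else 2)"

definition R_bas :: "complex \<Rightarrow> nat \<Rightarrow> nat \<Rightarrow> tensor" where
  "R_bas q i j =
     (if i = j then tscale q (bas [j, i])
      else if i > j then bas [j, i]
      else tadd (bas [j, i]) (tscale (q - inverse q) (bas [i, j])))"

definition S_bas :: "complex \<Rightarrow> nat \<Rightarrow> nat \<Rightarrow> tensor" where
  "S_bas q i j = (if vdeg i = vdeg j then R_bas q i j else bas [j, i])"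

definition R_VV :: "nat \<Rightarrow> complex \<Rightarrow> tensor \<Rightarrow> tensor" where
  "R_VV n q = lin_ext n 2 (\<lambda>xs. R_bas q (xs ! 0) (xs ! 1))"

definition S_VV :: "nat \<Rightarrow> complex \<Rightarrow> tensor \<Rightarrow> tensor" where
  "S_VV n q = lin_ext n 2 (\<lambda>xs. S_bas q (xs ! 0) (xs ! 1))"

definition d_V :: "nat \<Rightarrow> tensor \<Rightarrow> tensor" where
  "d_V n = lin_ext n 1 (\<lambda>xs. if xs ! 0 = 0 then tzero else bas xs)"

definition R_op :: "nat \<Rightarrow> nat \<Rightarrow> complex \<Rightarrow> nat \<Rightarrow> tensor \<Rightarrow> tensor" where
  "R_op n k q i =
     tensor_op n (i - 1) (2 + (k - i - 1)) (id_op n (i - 1))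
       (tensor_op n 2 (k - i - 1) (R_VV n q) (id_op n (k - i - 1)))"

definition S_op :: "nat \<Rightarrow> nat \<Rightarrow> complex \<Rightarrow> nat \<Rightarrow> tensor \<Rightarrow> tensor" where
  "S_op n k q i =
     tensor_op n (i - 1) (2 + (k - i - 1)) (id_op n (i - 1))
       (tensor_op n 2 (k - i - 1) (S_VV n q) (id_op n (k - i - 1)))"

definition d_op :: "nat \<Rightarrow> nat \<Rightarrow> nat \<Rightarrow> tensor \<Rightarrow> tensor" where
  "d_op n k i =
     tensor_op n (i - 1) (1 + (k - i)) (id_op n (i - 1))
       (tensor_op n 1 (k - i) (d_V n) (id_op n (k - i)))"

definition End_prod :: "nat \<Rightarrow> nat \<Rightarrow> (tensor \<Rightarrow> tensor) list \<Rightarrow> tensor \<Rightarrow> tensor" where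
  "End_prod n k As = foldr (monoid.mult (End_alg n k)) As (monoid.one (End_alg n k))"

definition X1_op :: "nat \<Rightarrow> nat \<Rightarrow> complex \<Rightarrow> tensor \<Rightarrow> tensor" where
  "X1_op n k q =
     End_prod n k
       (map (\<lambda>i. inv\<^bsub>End_alg n k\<^esub> (R_op n k q i)) [1..<k]
        @ map (S_op n k q) (rev [1..<k])
        @ [d_op n k 1])"

end

theory Submission
  imports Defs
begin

text \<open>
  On basis vectors \<open>v\<^sub>i \<otimes> v\<^sub>j\<close> with \<open>i \<noteq> 0\<close> the maps \<open>S\<close> and \<open>R\<close> agree: they differ only if
  exactly one index is \<open>0\<close>, and for \<open>i > 0 = j\<close> both are the plain swap. The extra term of
  \<open>R\<close> occurs only for \<open>i = 0 < j\<close>. So \<open>S\<^sub>i = R\<^sub>i\<close> on the span of the basis tensors whose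
  \<open>i\<close>-th factor is not \<open>v\<^sub>0\<close> (\<open>S_op_eq_R_op\<close>). Moreover \<open>R\<^sub>i\<close> maps this span into the
  corresponding one for \<open>i + 1\<close> (\<open>R_op_away\<close>), since \<open>v\<^sub>i \<otimes> v\<^sub>0\<close> becomes \<open>v\<^sub>0 \<otimes> v\<^sub>i\<close> and two
  nonzero indices stay nonzero.

  The image of \<open>d\<^sub>1\<close> is the span for \<open>i = 1\<close>. Hence, factor by factor from the right,
  \<open>S\<^bsub>k-1\<^esub> \<dots> S\<^sub>1 d\<^sub>1 = R\<^bsub>k-1\<^esub> \<dots> R\<^sub>1 d\<^sub>1\<close> (\<open>S_prod_eq_R_prod\<close>). The inverses
  \<open>R\<^sub>1\<^sup>-\<^sup>1 \<dots> R\<^bsub>k-1\<^esub>\<^sup>-\<^sup>1\<close>, which exist by the quadratic relation (\<open>R_op_Units\<close>), cancel the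
  product of the \<open>R\<^sub>i\<close> and leave \<open>d\<^sub>1\<close>.
\<close>

section \<open>Coordinates of tensor products of operators\<close>

lemma finite_idx [simp]: "finite (idx n m)"
proof -
  have "idx n m = {xs. set xs \<subseteq> {0..n} \<and> length xs = m}" by (auto simp: idx_def)
  then show ?thesis by (simp add: finite_lists_length_eq)
qed

lemma append_in_idx: "p \<in> idx n a \<Longrightarrow> s \<in> idx n b \<Longrightarrow> p @ s \<in> idx n (a + b)"
  by (auto simp: idx_def)

lemma length_idx: "p \<in> idx n a \<Longrightarrow> length p = a"
  by (simp add: idx_def)

lemma take_drop_in_idx:
  assumes "xs \<in> idx n (a + b)"
  shows "take a xs \<in> idx n a" "drop a xs \<in> idx n b"
  using assms by (auto simp: idx_def dest: in_set_takeD in_set_dropD)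

lemma idx_appendE:
  assumes "xs \<in> idx n (a + b)"
  obtains p s where "xs = p @ s" "p \<in> idx n a" "s \<in> idx n b"
  using take_drop_in_idx[OF assms] append_take_drop_id[of a xs] by metis

lemma idx_two_iff: "xs \<in> idx n 2 \<longleftrightarrow> (\<exists>i j. xs = [i, j] \<and> i \<le> n \<and> j \<le> n)"
  by (auto simp: idx_def numeral_2_eq_2 length_Suc_conv)

lemma idx_one_iff: "xs \<in> idx n 1 \<longleftrightarrow> (\<exists>i. xs = [i] \<and> i \<le> n)"
  by (auto simp: idx_def length_Suc_conv)

lemma local_degree:
  fixes i k :: nat
  shows "i \<in> {1..<k} \<Longrightarrow> i - 1 + (2 + (k - i - 1)) = k"
  unfolding atLeastLessThan_iff by arith

lemma idx_local_cases:
  assumes "ys \<in> idx n k" "i \<in> {1..<k}"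
  obtains p x y s where "ys = p @ [x, y] @ s" "p \<in> idx n (i - 1)" "s \<in> idx n (k - i - 1)"
    "x \<le> n" "y \<le> n"
proof -
  have "ys \<in> idx n (i - 1 + (2 + (k - i - 1)))" 
    using assms(1) by (simp only: local_degree[OF assms(2)])
  then obtain p r where "ys = p @ r" "p \<in> idx n (i - 1)" "r \<in> idx n (2 + (k - i - 1))"
    by (rule idx_appendE)
  moreover obtain m s where "r = m @ s" "m \<in> idx n 2" "s \<in> idx n (k - i - 1)"
    using \<open>r \<in> _\<close> by (rule idx_appendE)
  ultimately show ?thesis using that by (auto simp: idx_two_iff)
qed

lemma sum_idx_append:
  "(\<Sum>xs \<in> idx n (a + b). g xs) = (\<Sum>p \<in> idx n a. \<Sum>s \<in> idx n b. g (p @ s))"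
  unfolding sum.cartesian_product
  by (rule sum.reindex_bij_witness[of _ "\<lambda>(p, s). p @ s" "\<lambda>xs. (take a xs, drop a xs)"])
     (auto simp: append_in_idx length_idx take_drop_in_idx)

lemma tpow_eqI:
  assumes "u \<in> tpow n m" "w \<in> tpow n m" "\<And>ys. ys \<in> idx n m \<Longrightarrow> u ys = w ys"
  shows "u = w"
  using assms by (force simp: tpow_def)

lemma tpow_closed [simp]:
  "u \<in> tpow n m \<Longrightarrow> w \<in> tpow n m \<Longrightarrow> tadd u w \<in> tpow n m"
  "u \<in> tpow n m \<Longrightarrow> tscale c u \<in> tpow n m"
  "tzero \<in> tpow n m"
  by (auto simp: tpow_def tadd_def tscale_def tzero_def)

lemma bas_in_tpow [simp]: "bas xs \<in> tpow n m \<longleftrightarrow> xs \<in> idx n m"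
  by (auto simp: tpow_def bas_def)

lemma tensor_vec_append: "length p = a \<Longrightarrow> tensor_vec a u w (p @ s) = u p * w s"
  by (simp add: tensor_vec_def)

lemma tensor_vec_in_tpow:
  assumes "u \<in> tpow n a" "w \<in> tpow n b"
  shows "tensor_vec a u w \<in> tpow n (a + b)"
  unfolding tpow_def
proof (intro CollectI allI impI, rule ccontr)
  fix xs assume "xs \<notin> idx n (a + b)" "tensor_vec a u w xs \<noteq> 0"
  then have "take a xs \<in> idx n a" "drop a xs \<in> idx n b"
    using assms by (auto simp: tpow_def tensor_vec_def)
  then show False
    using append_in_idx[of "take a xs" n a "drop a xs" b] \<open>xs \<notin> _\<close> by simp
qed

lemma lin_ext_bas:
  assumes "xs \<in> idx n m"
  shows "lin_ext n m f (bas xs) = f xs"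
proof -
  have "(\<Sum>zs \<in> idx n m. bas xs zs * f zs ys) = f xs ys" for ys
  proof -
    have "(\<Sum>zs \<in> idx n m. bas xs zs * f zs ys) = (\<Sum>zs \<in> idx n m. if zs = xs then f zs ys else 0)"
      by (rule sum.cong) (auto simp: bas_def)
    then show ?thesis using assms by simp
  qed
  then show ?thesis using assms by (simp add: lin_ext_def)
qed

lemma id_op_bas: "xs \<in> idx n m \<Longrightarrow> id_op n m (bas xs) = bas xs"
  by (simp add: id_op_def)

lemma lin_ext_in_End:
  assumes "\<And>xs. xs \<in> idx n m \<Longrightarrow> f xs \<in> tpow n m"
  shows "lin_ext n m f \<in> carrier (End_alg n m)"
proof -
  have "(\<lambda>ys. \<Sum>xs \<in> idx n m. u xs * f xs ys) \<in> tpow n m" for u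
    using assms by (auto simp: tpow_def)
  then show ?thesis
    by (auto simp: End_alg_def lin_ext_def tadd_def[abs_def] tscale_def[abs_def]
        sum.distrib sum_distrib_left algebra_simps tpow_def)
qed

text \<open>
  Each of \<open>d\<^sub>i\<close>, \<open>R\<^sub>i\<close>, \<open>S\<^sub>i\<close> is of this form, with a map of degree \<open>l\<close> acting in between
  \<open>a\<close> and \<open>b\<close> untouched tensor factors.
\<close>

definition local_op ::
    "nat \<Rightarrow> nat \<Rightarrow> nat \<Rightarrow> nat \<Rightarrow> (nat list \<Rightarrow> tensor) \<Rightarrow> tensor \<Rightarrow> tensor" where
  "local_op n a l b f =
     tensor_op n a (l + b) (id_op n a) (tensor_op n l b (lin_ext n l f) (id_op n b))"

lemma local_op_in_End:
  assumes f: "\<And>m. m \<in> idx n l \<Longrightarrow> f m \<in> tpow n l"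
  shows "local_op n a l b f \<in> carrier (End_alg n (a + (l + b)))"
proof -
  have inner: "tensor_op n l b (lin_ext n l f) (id_op n b) (bas xs) \<in> tpow n (l + b)"
    if "xs \<in> idx n (l + b)" for xs
    using take_drop_in_idx[OF that] that f
    by (simp add: tensor_op_def lin_ext_bas id_op_bas tensor_vec_in_tpow)
  show ?thesis
    unfolding local_op_def tensor_op_def[of n a]
    by (rule lin_ext_in_End)
       (metis take_drop_in_idx inner id_op_bas bas_in_tpow tensor_vec_in_tpow)
qed

text \<open>The identity factors contribute Kronecker deltas, which collapse the outer sums.\<close>

lemma local_op_apply:
  assumes u: "u \<in> tpow n (a + (l + b))"
    and p: "p \<in> idx n a" and m: "m \<in> idx n l" and s: "s \<in> idx n b"
  shows "local_op n a l b f u (p @ m @ s) = (\<Sum>m' \<in> idx n l. u (p @ m' @ s) * f m' m)"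
proof -
  have inner: "tensor_op n l b (lin_ext n l f) (id_op n b) (bas (m' @ s')) (m @ s) =
      f m' m * bas s' s" if "m' \<in> idx n l" "s' \<in> idx n b" for m' s'
    using that m
    by (simp add: tensor_op_def lin_ext_bas id_op_bas append_in_idx length_idx tensor_vec_append)
  have "local_op n a l b f u (p @ m @ s) =
      (\<Sum>p' \<in> idx n a. \<Sum>m' \<in> idx n l. \<Sum>s' \<in> idx n b.
         u (p' @ m' @ s') * (bas p' p * (f m' m * bas s' s)))"
    using u p
    by (simp add: local_op_def tensor_op_def[of n a] lin_ext_def[of n "a + (l + b)"]
        sum_idx_append tensor_vec_append length_idx id_op_bas inner cong: sum.cong)
  also have "\<dots> = (\<Sum>p' \<in> idx n a. \<Sum>m' \<in> idx n l. \<Sum>s' \<in> idx n b.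
         if s = s' then (if p = p' then u (p' @ m' @ s') * f m' m else 0) else 0)"
    by (intro sum.cong) (auto simp: bas_def)
  also have "\<dots> = (\<Sum>p' \<in> idx n a. if p = p' then \<Sum>m' \<in> idx n l. u (p' @ m' @ s) * f m' m else 0)"
    using s by (intro sum.cong) auto
  also have "\<dots> = (\<Sum>m' \<in> idx n l. u (p @ m' @ s) * f m' m)"
    using p by simp
  finally show ?thesis .
qed

section \<open>The operators in coordinates\<close>

lemma R_op_local: "R_op n k q i =
    local_op n (i - 1) 2 (k - i - 1) (\<lambda>xs. R_bas q (xs ! 0) (xs ! 1))"
  by (simp add: R_op_def R_VV_def local_op_def)

lemma S_op_local: "S_op n k q i =
    local_op n (i - 1) 2 (k - i - 1) (\<lambda>xs. S_bas q (xs ! 0) (xs ! 1))"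
  by (simp add: S_op_def S_VV_def local_op_def)

lemma d_op_local: "d_op n k i =
    local_op n (i - 1) 1 (k - i) (\<lambda>xs. if xs ! 0 = 0 then tzero else bas xs)"
  by (simp add: d_op_def d_V_def local_op_def)

lemma R_bas_in_tpow: "i \<le> n \<Longrightarrow> j \<le> n \<Longrightarrow> R_bas q i j \<in> tpow n 2"
  by (simp add: R_bas_def idx_two_iff)

lemma S_bas_in_tpow: "i \<le> n \<Longrightarrow> j \<le> n \<Longrightarrow> S_bas q i j \<in> tpow n 2"
  by (simp add: S_bas_def R_bas_in_tpow idx_two_iff)

lemma R_op_in_End:
  assumes "i \<in> {1..<k}" shows "R_op n k q i \<in> carrier (End_alg n k)"
proof -
  have "i - 1 + (2 + (k - i - 1)) = k" using assms by (rule local_degree)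
  moreover have "R_op n k q i \<in> carrier (End_alg n (i - 1 + (2 + (k - i - 1))))"
    unfolding R_op_local by (rule local_op_in_End) (auto simp: idx_two_iff R_bas_in_tpow)
  ultimately show ?thesis by (simp only:)
qed

lemma S_op_in_End:
  assumes "i \<in> {1..<k}" shows "S_op n k q i \<in> carrier (End_alg n k)"
proof -
  have "i - 1 + (2 + (k - i - 1)) = k" using assms by (rule local_degree)
  moreover have "S_op n k q i \<in> carrier (End_alg n (i - 1 + (2 + (k - i - 1))))"
    unfolding S_op_local by (rule local_op_in_End) (auto simp: idx_two_iff S_bas_in_tpow)
  ultimately show ?thesis by (simp only:)
qed

lemma d_op_in_End:
  assumes "i \<in> {1..k}" shows "d_op n k i \<in> carrier (End_alg n k)"
proof -
  have "i - 1 + (1 + (k - i)) = k" using assms by simp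
  moreover have "d_op n k i \<in> carrier (End_alg n (i - 1 + (1 + (k - i))))"
    unfolding d_op_local by (rule local_op_in_End) auto
  ultimately show ?thesis by (simp only:)
qed

lemma R_bas_apply: "R_bas q i j [x, y] =
    (if [i, j] = [y, x] then if x = y then q else 1 else 0)
    + (if [i, j] = [x, y] then if x < y then q - inverse q else 0 else 0)"
  unfolding R_bas_def tadd_def tscale_def bas_def
  by (cases "i = x"; cases "i = y"; cases "j = x"; cases "j = y"; simp)

lemma S_bas_apply: "S_bas q i j [x, y] =
    (if [i, j] = [y, x] then if x = y then q else 1 else 0)
    + (if [i, j] = [x, y] then if x < y \<and> x \<noteq> 0 then q - inverse q else 0 else 0)"
  unfolding S_bas_def vdeg_def R_bas_def tadd_def tscale_def bas_def
  by (cases "i = x"; cases "i = y"; cases "j = x"; cases "j = y"; simp)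

text \<open>
  The matrix of \<open>R\<close> is read by rows, not by columns as in its definition: this leaves \<open>u\<close>
  arbitrary, so that identities between operators and the vanishing of coordinates can be
  checked one coordinate at a time.
\<close>

lemma R_op_apply:
  assumes i: "i \<in> {1..<k}" and u: "u \<in> tpow n k"
    and p: "p \<in> idx n (i - 1)" and s: "s \<in> idx n (k - i - 1)" and xy: "x \<le> n" "y \<le> n"
  shows "R_op n k q i u (p @ [x, y] @ s) =
    (if x = y then q else 1) * u (p @ [y, x] @ s)
    + (if x < y then (q - inverse q) * u (p @ [x, y] @ s) else 0)"
proof -
  have u': "u \<in> tpow n (i - 1 + (2 + (k - i - 1)))"
    using u by (simp only: local_degree[OF i])
  have m: "[x, y] \<in> idx n 2" using xy by (simp add: idx_two_iff)
  have "R_op n k q i u (p @ [x, y] @ s) =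
      (\<Sum>m \<in> idx n 2. u (p @ m @ s) * R_bas q (m ! 0) (m ! 1) [x, y])"
    unfolding R_op_local using u' p m s by (rule local_op_apply)
  also have "\<dots> = (\<Sum>m \<in> idx n 2.
      (if m = [y, x] then u (p @ m @ s) * (if x = y then q else 1) else 0)
      + (if m = [x, y] then u (p @ m @ s) * (if x < y then q - inverse q else 0) else 0))"
  proof (rule sum.cong[OF refl])
    fix m assume "m \<in> idx n 2"
    then obtain i j where m: "m = [i, j]" by (auto simp: idx_two_iff)
    show "u (p @ m @ s) * R_bas q (m ! 0) (m ! 1) [x, y] =
        (if m = [y, x] then u (p @ m @ s) * (if x = y then q else 1) else 0)
        + (if m = [x, y] then u (p @ m @ s) * (if x < y then q - inverse q else 0) else 0)"
      unfolding m by (simp only: nth_Cons_0 nth_Cons_Suc One_nat_def R_bas_apply distrib_left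
          if_distrib[of "\<lambda>c. u (p @ [i, j] @ s) * c"] mult_zero_right)
  qed
  also have "\<dots> = (if x = y then q else 1) * u (p @ [y, x] @ s)
      + (if x < y then (q - inverse q) * u (p @ [x, y] @ s) else 0)"
    using xy by (simp add: sum.distrib idx_two_iff)
  finally show ?thesis .
qed

lemma S_op_apply:
  assumes i: "i \<in> {1..<k}" and u: "u \<in> tpow n k"
    and p: "p \<in> idx n (i - 1)" and s: "s \<in> idx n (k - i - 1)" and xy: "x \<le> n" "y \<le> n"
  shows "S_op n k q i u (p @ [x, y] @ s) =
    (if x = y then q else 1) * u (p @ [y, x] @ s)
    + (if x < y \<and> x \<noteq> 0 then (q - inverse q) * u (p @ [x, y] @ s) else 0)"
proof -
  have u': "u \<in> tpow n (i - 1 + (2 + (k - i - 1)))"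
    using u by (simp only: local_degree[OF i])
  have m: "[x, y] \<in> idx n 2" using xy by (simp add: idx_two_iff)
  have "S_op n k q i u (p @ [x, y] @ s) =
      (\<Sum>m \<in> idx n 2. u (p @ m @ s) * S_bas q (m ! 0) (m ! 1) [x, y])"
    unfolding S_op_local using u' p m s by (rule local_op_apply)
  also have "\<dots> = (\<Sum>m \<in> idx n 2.
      (if m = [y, x] then u (p @ m @ s) * (if x = y then q else 1) else 0)
      + (if m = [x, y] then u (p @ m @ s) * (if x < y \<and> x \<noteq> 0 then q - inverse q else 0) else 0))"
  proof (rule sum.cong[OF refl])
    fix m assume "m \<in> idx n 2"
    then obtain i j where m: "m = [i, j]" by (auto simp: idx_two_iff)
    show "u (p @ m @ s) * S_bas q (m ! 0) (m ! 1) [x, y] =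
        (if m = [y, x] then u (p @ m @ s) * (if x = y then q else 1) else 0)
        + (if m = [x, y] then u (p @ m @ s) * (if x < y \<and> x \<noteq> 0 then q - inverse q else 0) else 0)"
      unfolding m by (simp only: nth_Cons_0 nth_Cons_Suc One_nat_def S_bas_apply distrib_left
          if_distrib[of "\<lambda>c. u (p @ [i, j] @ s) * c"] mult_zero_right)
  qed
  also have "\<dots> = (if x = y then q else 1) * u (p @ [y, x] @ s)
      + (if x < y \<and> x \<noteq> 0 then (q - inverse q) * u (p @ [x, y] @ s) else 0)"
    using xy by (simp add: sum.distrib idx_two_iff)
  finally show ?thesis .
qed

lemma End_closed: "A \<in> carrier (End_alg n k) \<Longrightarrow> u \<in> tpow n k \<Longrightarrow> A u \<in> tpow n k"
  by (auto simp: End_alg_def)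

lemma End_eqI:
  assumes "A \<in> carrier (End_alg n k)" "B \<in> carrier (End_alg n k)"
    "\<And>u. u \<in> tpow n k \<Longrightarrow> A u = B u"
  shows "A = B"
  using assms by (intro PiE_ext[of A "tpow n k" "\<lambda>_. tpow n k"]) (auto simp: End_alg_def)

lemma End_mult_apply: "u \<in> tpow n k \<Longrightarrow> (A \<otimes>\<^bsub>End_alg n k\<^esub> B) u = A (B u)"
  by (simp add: End_alg_def compose_def)

lemma d_op_apply:
  assumes k: "k \<ge> 1" and u: "u \<in> tpow n k"
  shows "d_op n k 1 u = (\<lambda>ys. if ys ! 0 = 0 then 0 else u ys)"
proof (rule tpow_eqI[of _ n k])
  show "d_op n k 1 u \<in> tpow n k"
    using d_op_in_End[of 1 k n] k u by (auto intro: End_closed)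
  show "(\<lambda>ys. if ys ! 0 = 0 then 0 else u ys) \<in> tpow n k"
    using u by (auto simp: tpow_def)
next
  fix ys assume "ys \<in> idx n k"
  then have "ys \<in> idx n (1 + (k - 1))" using k by simp
  then obtain m s where ys: "ys = m @ s" "m \<in> idx n 1" and s: "s \<in> idx n (k - 1)"
    by (rule idx_appendE)
  then obtain x where x: "m = [x]" "x \<le> n" by (auto simp: idx_one_iff[unfolded One_nat_def])
  have "d_op n k 1 u ([] @ [x] @ s) =
      (\<Sum>m \<in> idx n 1. u ([] @ m @ s) * (if m ! 0 = 0 then tzero else bas m) [x])"
    unfolding d_op_local using u k s x
    by (intro local_op_apply) (auto simp: idx_def)
  also have "\<dots> = (\<Sum>m \<in> idx n 1. if m = [x] then (if x = 0 then 0 else u (m @ s)) else 0)"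
    by (rule sum.cong) (auto simp: bas_def tzero_def)
  also have "\<dots> = (if x = 0 then 0 else u (x # s))"
    using ys(2) x(1) by simp
  finally show "d_op n k 1 u ys = (if ys ! 0 = 0 then 0 else u ys)"
    using ys x by simp
qed

section \<open>The endomorphism monoid and the invertibility of \<open>R\<^sub>i\<close>\<close>

lemma monoid_End: "monoid (End_alg n k)"
proof -
  have mult: "A \<otimes>\<^bsub>End_alg n k\<^esub> B \<in> carrier (End_alg n k)"
    if "A \<in> carrier (End_alg n k)" "B \<in> carrier (End_alg n k)" for A B
    using that End_closed[OF that(2)] by (auto simp: End_alg_def compose_def)
  have one: "\<one>\<^bsub>End_alg n k\<^esub> \<in> carrier (End_alg n k)"
    by (auto simp: End_alg_def id_op_def)
  have one_apply: "\<one>\<^bsub>End_alg n k\<^esub> u = u" if "u \<in> tpow n k" for u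
    using that by (simp add: End_alg_def id_op_def)
  show ?thesis
    by (rule monoidI)
       (auto intro!: End_eqI mult one simp: End_mult_apply one_apply End_closed)
qed

text \<open>
  \<open>R\<close> preserves the span of \<open>v\<^sub>x \<otimes> v\<^sub>y\<close> and \<open>v\<^sub>y \<otimes> v\<^sub>x\<close>. For \<open>x \<noteq> y\<close> it acts there with trace
  \<open>q - q\<^sup>-\<^sup>1\<close> and determinant \<open>-1\<close>; for \<open>x = y\<close> it is the root \<open>q\<close> of the same quadratic.
\<close>

lemma R_op_quadratic:
  assumes "q \<noteq> 0" and i: "i \<in> {1..<k}" and u: "u \<in> tpow n k"
  shows "R_op n k q i (R_op n k q i u) = tadd (tscale (q - inverse q) (R_op n k q i u)) u"
proof (rule tpow_eqI[of _ n k])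
  have Ru: "R_op n k q i u \<in> tpow n k" using R_op_in_End[OF i] u by (rule End_closed)
  then show "R_op n k q i (R_op n k q i u) \<in> tpow n k"
    using R_op_in_End[OF i] by (metis End_closed)
  show "tadd (tscale (q - inverse q) (R_op n k q i u)) u \<in> tpow n k"
    using Ru u by simp
  fix ys assume "ys \<in> idx n k"
  then obtain p x y s where ys: "ys = p @ [x, y] @ s" and "p \<in> idx n (i - 1)"
    "s \<in> idx n (k - i - 1)" "x \<le> n" "y \<le> n" using i by (rule idx_local_cases)
  note R_apply = R_op_apply[OF i _ this(2,3)] \<open>x \<le> n\<close> \<open>y \<le> n\<close>
  show "R_op n k q i (R_op n k q i u) ys = tadd (tscale (q - inverse q) (R_op n k q i u)) u ys"
    unfolding ys tadd_def tscale_def using u Ru \<open>q \<noteq> 0\<close>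
    by (cases x y rule: linorder_cases)
       (simp_all only: R_apply, simp_all add: field_simps)
qed

text \<open>The quadratic relation exhibits \<open>R\<^sub>i - (q - q\<^sup>-\<^sup>1)\<close> as the inverse of \<open>R\<^sub>i\<close>.\<close>

lemma R_op_Units:
  assumes "q \<noteq> 0" and i: "i \<in> {1..<k}"
  shows "R_op n k q i \<in> Units (End_alg n k)"
proof -
  interpret monoid "End_alg n k" by (rule monoid_End)
  let ?R = "R_op n k q i" and ?c = "q - inverse q"
  define R' where "R' = (\<lambda>u \<in> tpow n k. tadd (?R u) (tscale (- ?c) u))"
  have R: "?R \<in> carrier (End_alg n k)" using i by (rule R_op_in_End)
  have lin: "?R (tadd u w) = tadd (?R u) (?R w)" "?R (tscale c u) = tscale c (?R u)"
    if "u \<in> tpow n k" "w \<in> tpow n k" for u w c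
    using R that by (auto simp: End_alg_def)
  have closed: "?R u \<in> tpow n k" if "u \<in> tpow n k" for u
    using R that by (rule End_closed)
  have R': "R' \<in> carrier (End_alg n k)"
    using lin closed
    by (auto simp: End_alg_def R'_def) (auto simp: tadd_def tscale_def algebra_simps)
  have cancel: "tadd (tadd (tscale c w) u) (tscale (- c) w) = u" for c u w
    by (simp add: tadd_def tscale_def)
  have "?R \<otimes>\<^bsub>End_alg n k\<^esub> R' = \<one>\<^bsub>End_alg n k\<^esub>"
  proof (rule End_eqI[OF m_closed[OF R R'] one_closed])
    fix u assume u: "u \<in> tpow n k"
    then show "(?R \<otimes>\<^bsub>End_alg n k\<^esub> R') u = \<one>\<^bsub>End_alg n k\<^esub> u"
      by (simp add: End_mult_apply R'_def lin closed R_op_quadratic[OF assms] cancel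
          del: minus_diff_eq) (simp add: End_alg_def id_op_def)
  qed
  moreover have "R' \<otimes>\<^bsub>End_alg n k\<^esub> ?R = \<one>\<^bsub>End_alg n k\<^esub>"
  proof (rule End_eqI[OF m_closed[OF R' R] one_closed])
    fix u assume u: "u \<in> tpow n k"
    then show "(R' \<otimes>\<^bsub>End_alg n k\<^esub> ?R) u = \<one>\<^bsub>End_alg n k\<^esub> u"
      by (simp add: End_mult_apply R'_def lin closed R_op_quadratic[OF assms] cancel
          del: minus_diff_eq) (simp add: End_alg_def id_op_def)
  qed
  ultimately show ?thesis using R R' by (auto simp: Units_def)
qed

lemma (in monoid) foldr_mult_closed:
  "set gs \<subseteq> carrier G \<Longrightarrow> z \<in> carrier G \<Longrightarrow> foldr (\<otimes>) gs z \<in> carrier G"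
  by (induction gs) auto

lemma (in monoid) foldr_inv_rev_cancel:
  assumes "set gs \<subseteq> Units G" "z \<in> carrier G"
  shows "foldr (\<otimes>) (map (\<lambda>g. inv g) gs @ rev gs) z = z"
  using assms
proof (induction gs rule: rev_induct)
  case (snoc g gs)
  have "set (rev gs) \<subseteq> carrier G" using snoc.prems by (auto intro: Units_closed)
  then have "foldr (\<otimes>) (rev gs) z \<in> carrier G" using snoc.prems by (metis foldr_mult_closed)
  then have "inv g \<otimes> (g \<otimes> foldr (\<otimes>) (rev gs) z) = foldr (\<otimes>) (rev gs) z"
    using snoc.prems by (simp add: m_assoc[symmetric] Units_closed Units_l_inv)
  then show ?case using snoc by simp
qed simp

section \<open>Replacing \<open>S\<^sub>i\<close> by \<open>R\<^sub>i\<close>\<close>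

text \<open>The span of the basis tensors whose \<open>i\<close>-th factor (counted from \<open>1\<close>) is not \<open>v\<^sub>0\<close>.\<close>

definition away :: "nat \<Rightarrow> nat \<Rightarrow> nat \<Rightarrow> tensor set" where
  "away n k i = {u \<in> tpow n k. \<forall>ys \<in> idx n k. ys ! (i - 1) = 0 \<longrightarrow> u ys = 0}"

lemma away_apply:
  assumes "u \<in> away n k i" "i \<in> {1..<k}" "p \<in> idx n (i - 1)" "s \<in> idx n (k - i - 1)" "y \<le> n"
  shows "u (p @ [0, y] @ s) = 0"
proof -
  have "p @ [0, y] @ s \<in> idx n k" using assms by (auto simp: idx_def)
  moreover have "(p @ [0, y] @ s) ! (i - 1) = 0" using assms(3) by (simp add: nth_append idx_def)
  ultimately show ?thesis using assms(1) by (auto simp: away_def)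
qed

text \<open>
  By rows, \<open>R\<close> and \<open>S\<close> differ only in the term \<open>(q - q\<^sup>-\<^sup>1) w(0, y)\<close> of the coordinate at
  \<open>(0, y)\<close> with \<open>y > 0\<close>, and this term vanishes here.
\<close>

lemma S_op_eq_R_op:
  assumes i: "i \<in> {1..<k}" and u: "u \<in> away n k i"
  shows "S_op n k q i u = R_op n k q i u"
proof (rule tpow_eqI[of _ n k])
  have u': "u \<in> tpow n k" using u by (simp add: away_def)
  show "S_op n k q i u \<in> tpow n k" using S_op_in_End[OF i] u' by (rule End_closed)
  show "R_op n k q i u \<in> tpow n k" using R_op_in_End[OF i] u' by (rule End_closed)
  fix ys assume "ys \<in> idx n k"
  then obtain p x y s where ys: "ys = p @ [x, y] @ s" and ps: "p \<in> idx n (i - 1)"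
    "s \<in> idx n (k - i - 1)" and xy: "x \<le> n" "y \<le> n" using i by (rule idx_local_cases)
  show "S_op n k q i u ys = R_op n k q i u ys"
    unfolding ys R_op_apply[OF i u' ps xy] S_op_apply[OF i u' ps xy]
    using away_apply[OF u i ps xy(2)] by (cases "x = 0") auto
qed

lemma R_op_away:
  assumes i: "i \<in> {1..<k}" and u: "u \<in> away n k i"
  shows "R_op n k q i u \<in> away n k (Suc i)"
  unfolding away_def
proof (intro CollectI conjI ballI impI)
  have u': "u \<in> tpow n k" using u by (simp add: away_def)
  show "R_op n k q i u \<in> tpow n k" using R_op_in_End[OF i] u' by (rule End_closed)
  fix ys assume "ys \<in> idx n k" and y0: "ys ! (Suc i - 1) = 0"
  obtain p x y s where ys: "ys = p @ [x, y] @ s" and ps: "p \<in> idx n (i - 1)"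
    "s \<in> idx n (k - i - 1)" and xy: "x \<le> n" "y \<le> n"
    using \<open>ys \<in> _\<close> i by (rule idx_local_cases)
  have "i = Suc (length p)" using i ps(1) by (auto simp: idx_def)
  then have "y = 0" using y0 by (simp add: ys nth_append)
  then show "R_op n k q i u ys = 0"
    unfolding ys R_op_apply[OF i u' ps xy]
    using away_apply[OF u i ps xy(1)] by simp
qed

text \<open>
  The second conjunct drives the induction: it places the image of the partial product where
  the next factors \<open>S\<^sub>m\<close> and \<open>R\<^sub>m\<close> agree.
\<close>

lemma S_prod_eq_R_prod:
  assumes "D \<in> carrier (End_alg n k)" "\<And>u. u \<in> tpow n k \<Longrightarrow> D u \<in> away n k 1" "1 \<le> m" "m \<le> k"
  shows "foldr (\<otimes>\<^bsub>End_alg n k\<^esub>) (map (S_op n k q) (rev [1..<m])) D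
       = foldr (\<otimes>\<^bsub>End_alg n k\<^esub>) (map (R_op n k q) (rev [1..<m])) D
     \<and> (\<forall>u \<in> tpow n k.
          foldr (\<otimes>\<^bsub>End_alg n k\<^esub>) (map (R_op n k q) (rev [1..<m])) D u \<in> away n k m)"
  using assms(3,4)
proof (induction m rule: dec_induct)
  case base
  then show ?case using assms(2) by simp
next
  case (step m)
  interpret monoid "End_alg n k" by (rule monoid_End)
  let ?P = "foldr (\<otimes>\<^bsub>End_alg n k\<^esub>) (map (R_op n k q) (rev [1..<m])) D"
  have m: "m \<in> {1..<k}" using step by simp
  have P: "?P \<in> carrier (End_alg n k)"
    using assms(1) step by (intro foldr_mult_closed) (auto intro!: R_op_in_End)
  have IH: "foldr (\<otimes>\<^bsub>End_alg n k\<^esub>) (map (S_op n k q) (rev [1..<m])) D = ?P"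
    "\<And>u. u \<in> tpow n k \<Longrightarrow> ?P u \<in> away n k m"
    using step by auto
  have "S_op n k q m \<otimes>\<^bsub>End_alg n k\<^esub> ?P = R_op n k q m \<otimes>\<^bsub>End_alg n k\<^esub> ?P"
    by (rule End_eqI[OF m_closed[OF S_op_in_End[OF m] P] m_closed[OF R_op_in_End[OF m] P]])
       (simp only: End_mult_apply S_op_eq_R_op[OF m IH(2)])
  moreover have "(R_op n k q m \<otimes>\<^bsub>End_alg n k\<^esub> ?P) u \<in> away n k (Suc m)" if "u \<in> tpow n k" for u
    using that by (simp only: End_mult_apply R_op_away[OF m IH(2)])
  ultimately show ?case using \<open>1 \<le> m\<close> IH(1) by simp
qed

lemma X1_op_eq_d_op:
  assumes "q \<noteq> 0" "k \<ge> 1"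
  shows "X1_op n k q = d_op n k 1"
proof -
  interpret monoid "End_alg n k" by (rule monoid_End)
  let ?d = "d_op n k 1" and ?Rs = "map (R_op n k q) [1..<k]"
  have d: "?d \<in> carrier (End_alg n k)" using assms by (intro d_op_in_End) simp
  have d_away: "?d u \<in> away n k 1" if "u \<in> tpow n k" for u
    using End_closed[OF d that] d_op_apply[OF assms(2) that] by (simp add: away_def)
  have Rs: "set ?Rs \<subseteq> Units (End_alg n k)" using R_op_Units[OF assms(1)] by auto
  have "X1_op n k q = foldr (\<otimes>\<^bsub>End_alg n k\<^esub>) (map (\<lambda>i. inv\<^bsub>End_alg n k\<^esub> (R_op n k q i)) [1..<k])
      (foldr (\<otimes>\<^bsub>End_alg n k\<^esub>) (map (S_op n k q) (rev [1..<k])) ?d)"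
    using d by (simp add: X1_op_def End_prod_def)
  also have "\<dots> = foldr (\<otimes>\<^bsub>End_alg n k\<^esub>) (map (\<lambda>A. inv\<^bsub>End_alg n k\<^esub> A) ?Rs @ rev ?Rs) ?d"
    using S_prod_eq_R_prod[OF d d_away \<open>k \<ge> 1\<close> order_refl, of q] by (simp add: rev_map comp_def)
  also have "\<dots> = ?d" using Rs d by (rule foldr_inv_rev_cancel)
  finally show ?thesis .
qed

theorem mainTheorem6:
  fixes q :: complex and n k :: nat
    and \<Phi> :: "ncpoly set \<Rightarrow> (tensor \<Rightarrow> tensor)"
  assumes "q \<noteq> 0" and "n \<ge> 1" and "k \<ge> 1"
    and action: "\<Phi> \<in> calg_hom (hecke_alg k q) (End_alg n k)"
    and action_T: "\<forall>i \<in> {1..<k}. \<Phi> (hecke_class k q (T i)) = R_op n k q i"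
    and action_X1: "\<Phi> (hecke_class k q X\<^sub>1) = X1_op n k q"
  shows "\<Phi> (hecke_class k q X\<^sub>1) = d_op n k 1
    \<and> (\<forall>js \<in> idx n (k - 1).
          \<Phi> (hecke_class k q X\<^sub>1) (bas (0 # js)) = tzero)
    \<and> (\<forall>l \<in> {1..n}. \<forall>js \<in> idx n (k - 1).
          \<Phi> (hecke_class k q X\<^sub>1) (bas (l # js)) = bas (l # js))"
proof -
  have X1: "\<Phi> (hecke_class k q X\<^sub>1) = d_op n k 1"
    using action_X1 X1_op_eq_d_op assms by simp
  moreover have "d_op n k 1 (bas (l # js)) = (if l = 0 then tzero else bas (l # js))"
    if "l \<le> n" "js \<in> idx n (k - 1)" for l js
  proof -
    have "l # js \<in> idx n k" using that \<open>k \<ge> 1\<close> by (auto simp: idx_def)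
    then have "d_op n k 1 (bas (l # js)) = (\<lambda>ys. if ys ! 0 = 0 then 0 else bas (l # js) ys)"
      using \<open>k \<ge> 1\<close> by (intro d_op_apply) simp_all
    then show ?thesis by (auto simp: bas_def tzero_def)
  qed
  ultimately show ?thesis by auto
qed

end
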